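(* Let $u,w\in\mathcal{D}(E)$, let $T=M_wEM_u$, $Tf=wE(uf)$, be bounded on $L^2(\Sigma)$, and suppose that $|E(uw)|^2=E(|u|^2)E(|w|^2)$ $\mu$-a.e. Then $$\sigma_p(M_wEM_u)=\sigma_{jp}(M_wEM_u).$$
   Context: $(X,\Sigma,\mu)$ is a complete $\sigma$-finite measure space and $\mathcal{A}\subseteq\Sigma$ is a sub-$\sigma$-algebra such that $(X,\mathcal{A},\mu|_{\mathcal{A}})$ is $\sigma$-finite. $L^2(\Sigma)=L^2(X,\Sigma,\mu)$ (complex-valued functions). $L^0(\Sigma)$ is the space of a.e. classes of a.e. finite-valued $\Sigma$-measurable functions, and $L^0(\mathcal{A})$ is its analogue for $\mathcal{A}$. $E=E^{\mathcal{A}}$ is the conditional expectation with respect to $\mathcal{A}$: $E(f)$ is the unique $\mathcal{A}$-measurable function with $\int_A f\,d\mu=\int_A E(f)\,d\mu$ for $A\in\mathcal{A}$, for non-negative measurable $f$ and for $f\in L^2(\Sigma)$, and it extends in the usual way to $\mathcal{D}(E)=\{g\in L^0(\Sigma): E(|g|)\in L^0(\mathcal{A})\}$. $M_u$ denotes multiplication by $u$. For a bounded operator $T$ on a Hilbert space, the point spectrum $\sigma_p(T)$ is the set of $\lambda\in\mathbb{C}$ for which there is a unit vector $x$ with $(T-\lambda)x=0$; the joint point spectrum $\sigma_{jp}(T)$ is the set of $\lambda\in\mathbb{C}$ for which there is a unit vector $x$ with both $(T-\lambda)x=0$ and $(T^*-\bar\lambda)x=0$. *)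

theory Defs
  imports "HOL-Probability.Probability"
begin

text \<open>
  Classes modulo \<open>\<mu>\<close>-a.e. equality are handled through representatives: elements of
  \<open>L\<^sup>0\<close> and \<open>L\<^sup>2\<close> are everywhere finite measurable functions into the complex numbers, and
  equations between them are asserted a.e.  The sub-\<open>\<sigma>\<close>-algebra is \<open>sets F\<close> for a measure \<open>F\<close> with
  \<open>subalgebra M F\<close>, as in \<^theory>\<open>HOL-Probability.Conditional_Expectation\<close>; the measure
  carried by \<open>F\<close> itself plays no role.
\<close>

definition cond_exp_dom :: "'a measure \<Rightarrow> 'a measure \<Rightarrow> ('a \<Rightarrow> complex) set" where
  "cond_exp_dom M F =
     {g \<in> borel_measurable M. AE x in M. nn_cond_exp M F (\<lambda>y. ennreal (cmod (g y))) x < \<infinity>}"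

text \<open>
  On \<^const>\<open>cond_exp_dom\<close> the four nonnegative conditional expectations entering here (those of the
  positive and negative parts of \<open>Re f\<close> and \<open>Im f\<close>) are a.e. finite, and this is the usual extension
  of \<open>E\<close>.  Outside that domain the value carries no meaning, as \<^const>\<open>real_cond_exp\<close> replaces
  infinite values by 0.
\<close>

definition complex_cond_exp ::
    "'a measure \<Rightarrow> 'a measure \<Rightarrow> ('a \<Rightarrow> complex) \<Rightarrow> 'a \<Rightarrow> complex" where
  "complex_cond_exp M F f =
     (\<lambda>x. Complex (real_cond_exp M F (\<lambda>y. Re (f y)) x) (real_cond_exp M F (\<lambda>y. Im (f y)) x))"

definition weighted_cond_op ::
    "'a measure \<Rightarrow> 'a measure \<Rightarrow> ('a \<Rightarrow> complex) \<Rightarrow> ('a \<Rightarrow> complex) \<Rightarrow> ('a \<Rightarrow> complex) \<Rightarrow> 'a \<Rightarrow> complex" where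
  "weighted_cond_op M F w u f = (\<lambda>x. w x * complex_cond_exp M F (\<lambda>y. u y * f y) x)"

definition L2_space :: "'a measure \<Rightarrow> ('a \<Rightarrow> complex) set" where
  "L2_space M = {f \<in> borel_measurable M. integrable M (\<lambda>x. (cmod (f x))\<^sup>2)}"

definition L2_norm :: "'a measure \<Rightarrow> ('a \<Rightarrow> complex) \<Rightarrow> real" where
  "L2_norm M f = sqrt (\<integral>x. (cmod (f x))\<^sup>2 \<partial>M)"

definition L2_inner :: "'a measure \<Rightarrow> ('a \<Rightarrow> complex) \<Rightarrow> ('a \<Rightarrow> complex) \<Rightarrow> complex" where
  "L2_inner M f g = (\<integral>x. f x * cnj (g x) \<partial>M)"

text \<open>
  Linearity modulo a.e. equality is not part of the next definition; it holds automatically for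
  \<^const>\<open>weighted_cond_op\<close> whenever \<open>u f\<close> lies in the domain of \<open>E\<close> for every \<open>f\<close> in \<open>L\<^sup>2\<close>.
\<close>

definition L2_bounded :: "'a measure \<Rightarrow> (('a \<Rightarrow> complex) \<Rightarrow> 'a \<Rightarrow> complex) \<Rightarrow> bool" where
  "L2_bounded M T \<longleftrightarrow>
     (\<forall>f\<in>L2_space M. T f \<in> L2_space M) \<and>
     (\<exists>C. \<forall>f\<in>L2_space M. L2_norm M (T f) \<le> C * L2_norm M f)"

text \<open>
  For a bounded linear operator \<open>T\<close> and \<open>g\<close> in \<open>L\<^sup>2\<close>, the function chosen here exists by the Riesz
  representation theorem and is unique up to a.e. equality.
\<close>

definition L2_adjoint ::
    "'a measure \<Rightarrow> (('a \<Rightarrow> complex) \<Rightarrow> 'a \<Rightarrow> complex) \<Rightarrow> ('a \<Rightarrow> complex) \<Rightarrow> 'a \<Rightarrow> complex" where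
  "L2_adjoint M T g =
     (SOME h. h \<in> L2_space M \<and> (\<forall>f\<in>L2_space M. L2_inner M (T f) g = L2_inner M f h))"

definition point_spectrum ::
    "'a measure \<Rightarrow> (('a \<Rightarrow> complex) \<Rightarrow> 'a \<Rightarrow> complex) \<Rightarrow> complex set" where
  "point_spectrum M T =
     {z. \<exists>f\<in>L2_space M. L2_norm M f = 1 \<and> (AE x in M. T f x - z * f x = 0)}"

definition joint_point_spectrum ::
    "'a measure \<Rightarrow> (('a \<Rightarrow> complex) \<Rightarrow> 'a \<Rightarrow> complex) \<Rightarrow> complex set" where
  "joint_point_spectrum M T =
     {z. \<exists>f\<in>L2_space M. L2_norm M f = 1 \<and> (AE x in M. T f x - z * f x = 0) \<and>
           (AE x in M. L2_adjoint M T f x - cnj z * f x = 0)}"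

end

theory Submission
  imports Defs
begin

text \<open>
  Equality in the conditional Cauchy--Schwarz inequality forces \<open>cnj u\<close> and \<open>w\<close> to be proportional
  over the \<open>F\<close>-measurable functions: \<open>cnj u = \<kappa> w\<close> on the set where \<open>E \<bar>u\<bar>\<^sup>2 E \<bar>w\<bar>\<^sup>2 > 0\<close>
  (\<open>cond_cauchy_schwarz_equality_imp_collinear\<close>).  Off this set \<open>u\<close> or \<open>w\<close> vanishes together
  with its conditional second moment, and so does \<open>T f = w E (u f)\<close>.  Letting \<open>v\<close> be \<open>w\<close> cut off to
  this set, one obtains \<open>T f = cnj \<kappa> v E (cnj v f)\<close> (\<open>weighted_cond_op_normal_form\<close>), that is,
  \<open>T = M\<^bsub>cnj \<kappa>\<^esub> A\<close> with the positive operator \<open>A f = v E (cnj v f)\<close>, which commutes with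
  multiplication by \<open>F\<close>-measurable functions.

  Such an operator is normal with adjoint \<open>T\<^sup>* f = \<kappa> v E (cnj v f)\<close>
  (\<open>L2_adjoint_normal_form\<close>), and normal operators satisfy \<open>ker (T - z) = ker (T\<^sup>* - cnj z)\<close>.
  Here the last point is a pointwise computation (\<open>normal_form_eigenvector\<close>): with
  \<open>G = E (cnj v f)\<close>, the equation \<open>T f = z f\<close> implies \<open>cnj \<kappa> E \<bar>v\<bar>\<^sup>2 G = z G\<close>, so \<open>z\<close> equals
  \<open>cnj \<kappa> E \<bar>v\<bar>\<^sup>2\<close> wherever \<open>G\<close> is nonzero, and conjugating this value exchanges \<open>\<kappa>\<close> with
  \<open>cnj \<kappa>\<close>.

  The functions \<open>u f\<close>, \<open>v f\<close> and \<open>\<bar>w\<bar>\<^sup>2\<close> need not be integrable; they only have finite conditional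
  expectation on suitable \<open>F\<close>-sets.  The rules for \<open>E\<close> are therefore extended first:
  locality on \<open>F\<close>-sets holds unconditionally, and \<open>F\<close>-measurable factors can be pulled out wherever
  \<open>E \<bar>g\<bar>\<close> is finite, since multiplying by a suitable positive \<open>F\<close>-measurable weight reduces this to
  the integrable case.
\<close>

section \<open>Conditional expectation without integrability\<close>

lemma cmod_mult_le_sum_squares: "cmod (a * b) \<le> (cmod a)\<^sup>2 + (cmod b)\<^sup>2"
proof -
  have "2 * cmod a * cmod b \<le> (cmod a)\<^sup>2 + (cmod b)\<^sup>2"
    by (rule sum_squares_bound)
  moreover have "0 \<le> cmod a * cmod b" by simp
  ultimately show ?thesis by (simp only: norm_mult)
qed

lemma borel_measurable_cnj_compose [measurable (raw)]:
  "f \<in> borel_measurable M \<Longrightarrow> (\<lambda>x. cnj (f x)) \<in> borel_measurable M"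
  by (rule borel_measurable_continuous_on[where g = f and f = cnj]) (auto intro: continuous_intros)

lemma complex_cond_exp_measurable [measurable]:
  "complex_cond_exp M F g \<in> borel_measurable F"
  "complex_cond_exp M F g \<in> borel_measurable M"
  unfolding complex_cond_exp_def Complex_eq by measurable

lemma complex_cond_exp_cnj:
  "complex_cond_exp M F (\<lambda>x. cnj (g x)) x = cnj (complex_cond_exp M F g x)"
  unfolding complex_cond_exp_def real_cond_exp_def by (simp add: complex_eq_iff)

context sigma_finite_subalgebra
begin

lemma measurable_from_F [measurable_dest]: "f \<in> measurable F N \<Longrightarrow> f \<in> measurable M N"
  using measurable_from_subalg[OF subalg] .

lemma in_sets_from_F: "A \<in> sets F \<Longrightarrow> A \<in> sets M"
  using subalg by (auto simp: subalgebra_def)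

text \<open>
  Locality extends beyond the domain of \<open>E\<close>: the indicator of an \<open>F\<close>-set commutes with the
  conditional expectation of each nonnegative part, including where that expectation is infinite.
\<close>

lemma nn_cond_exp_local:
  assumes A: "A \<in> sets F" and [measurable]: "g \<in> borel_measurable M" "h \<in> borel_measurable M"
    and eq: "AE x in M. x \<in> A \<longrightarrow> g x = h x"
  shows "AE x in M. x \<in> A \<longrightarrow> nn_cond_exp M F g x = nn_cond_exp M F h x"
proof -
  have [measurable]: "A \<in> sets F" "A \<in> sets M" using A in_sets_from_F by auto
  have "AE x in M. nn_cond_exp M F (\<lambda>x. indicator A x * g x) x
      = nn_cond_exp M F (\<lambda>x. indicator A x * h x) x"
    by (rule nn_cond_exp_cong) (use eq in \<open>auto simp: indicator_def elim!: AE_mp\<close>)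
  moreover have "AE x in M. indicator A x * nn_cond_exp M F g x = nn_cond_exp M F (\<lambda>x. indicator A x * g x) x"
    using nn_cond_exp_prod[of "indicator A" g] by auto
  moreover have "AE x in M. indicator A x * nn_cond_exp M F h x = nn_cond_exp M F (\<lambda>x. indicator A x * h x) x"
    using nn_cond_exp_prod[of "indicator A" h] by auto
  ultimately show ?thesis
    by eventually_elim (auto simp: indicator_def split: if_splits)
qed

lemma real_cond_exp_local:
  assumes A: "A \<in> sets F" and [measurable]: "g \<in> borel_measurable M" "h \<in> borel_measurable M"
    and eq: "AE x in M. x \<in> A \<longrightarrow> g x = h x"
  shows "AE x in M. x \<in> A \<longrightarrow> real_cond_exp M F g x = real_cond_exp M F h x"
proof -
  have "AE x in M. x \<in> A \<longrightarrow> nn_cond_exp M F (\<lambda>x. ennreal (g x)) x = nn_cond_exp M F (\<lambda>x. ennreal (h x)) x"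
    by (rule nn_cond_exp_local[OF A]) (use eq in auto)
  moreover have "AE x in M. x \<in> A \<longrightarrow> nn_cond_exp M F (\<lambda>x. ennreal (- g x)) x = nn_cond_exp M F (\<lambda>x. ennreal (- h x)) x"
    by (rule nn_cond_exp_local[OF A]) (use eq in auto)
  ultimately show ?thesis
    by eventually_elim (simp add: real_cond_exp_def)
qed

lemma complex_cond_exp_local:
  fixes g h :: "'a \<Rightarrow> complex"
  assumes A: "A \<in> sets F" and [measurable]: "g \<in> borel_measurable M" "h \<in> borel_measurable M"
    and eq: "AE x in M. x \<in> A \<longrightarrow> g x = h x"
  shows "AE x in M. x \<in> A \<longrightarrow> complex_cond_exp M F g x = complex_cond_exp M F h x"
proof -
  have "AE x in M. x \<in> A \<longrightarrow> real_cond_exp M F (\<lambda>x. Re (g x)) x = real_cond_exp M F (\<lambda>x. Re (h x)) x"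
    by (rule real_cond_exp_local[OF A]) (use eq in auto)
  moreover have "AE x in M. x \<in> A \<longrightarrow> real_cond_exp M F (\<lambda>x. Im (g x)) x = real_cond_exp M F (\<lambda>x. Im (h x)) x"
    by (rule real_cond_exp_local[OF A]) (use eq in auto)
  ultimately show ?thesis
    by eventually_elim (simp add: complex_cond_exp_def)
qed

lemma complex_cond_exp_cong:
  fixes g h :: "'a \<Rightarrow> complex"
  assumes [measurable]: "g \<in> borel_measurable M" "h \<in> borel_measurable M"
    and eq: "AE x in M. g x = h x"
  shows "AE x in M. complex_cond_exp M F g x = complex_cond_exp M F h x"
proof -
  have "space M \<in> sets F"
    using subalg by (metis sets.top subalgebra_def)
  from complex_cond_exp_local[OF this, of g h] eq show ?thesis
    by auto
qed

lemma complex_cond_exp_of_nonneg: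
  fixes r :: "'a \<Rightarrow> real"
  assumes [measurable]: "r \<in> borel_measurable M" and nonneg: "\<And>x. 0 \<le> r x"
  shows "AE x in M. complex_cond_exp M F (\<lambda>x. of_real (r x)) x
    = of_real (enn2real (nn_cond_exp M F (\<lambda>x. ennreal (r x)) x))"
proof -
  have zero: "AE x in M. 0 = nn_cond_exp M F (\<lambda>x. 0) x"
    using nn_cond_exp_F_meas[of "\<lambda>_. 0"] by auto
  have "ennreal (- r x) = 0" for x
    using nonneg[of x] by (simp add: ennreal_neg)
  then show ?thesis
    using zero by (auto simp: complex_cond_exp_def real_cond_exp_def complex_eq_iff elim!: AE_mp)
qed

text \<open>
  Componentwise reduction to the real case; each of the four real products is dominated by
  \<open>\<bar>p g\<bar>\<close>, so integrability of the complex product suffices.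
\<close>

lemma complex_cond_exp_intg:
  fixes p g :: "'a \<Rightarrow> complex"
  assumes int: "integrable M (\<lambda>x. p x * g x)"
    and [measurable]: "p \<in> borel_measurable F" "g \<in> borel_measurable M"
  shows "integrable M (\<lambda>x. p x * complex_cond_exp M F g x)"
    and "(\<integral>x. p x * complex_cond_exp M F g x \<partial>M) = (\<integral>x. p x * g x \<partial>M)"
    and "AE x in M. complex_cond_exp M F (\<lambda>y. p y * g y) x = p x * complex_cond_exp M F g x"
proof -
  let ?Rp = "\<lambda>x. Re (p x)" and ?Ip = "\<lambda>x. Im (p x)"
  let ?Rg = "\<lambda>x. Re (g x)" and ?Ig = "\<lambda>x. Im (g x)"
  let ?ER = "real_cond_exp M F ?Rg" and ?EI = "real_cond_exp M F ?Ig"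
  have bound: "\<bar>s * t\<bar> \<le> cmod (a * b)" if "\<bar>s\<bar> \<le> cmod a" "\<bar>t\<bar> \<le> cmod b" for s t a b
    using that by (auto simp: abs_mult norm_mult intro!: mult_mono)
  have i1: "integrable M (\<lambda>x. ?Rp x * ?Rg x)"
    by (rule Bochner_Integration.integrable_bound[OF int])
      (auto intro!: AE_I2 bound abs_Re_le_cmod)
  have i2: "integrable M (\<lambda>x. ?Ip x * ?Ig x)"
    by (rule Bochner_Integration.integrable_bound[OF int])
      (auto intro!: AE_I2 bound abs_Im_le_cmod)
  have i3: "integrable M (\<lambda>x. ?Rp x * ?Ig x)"
    by (rule Bochner_Integration.integrable_bound[OF int])
      (auto intro!: AE_I2 bound abs_Re_le_cmod abs_Im_le_cmod)
  have i4: "integrable M (\<lambda>x. ?Ip x * ?Rg x)"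
    by (rule Bochner_Integration.integrable_bound[OF int])
      (auto intro!: AE_I2 bound abs_Re_le_cmod abs_Im_le_cmod)
  note e1 = real_cond_exp_intg[OF i1] and e2 = real_cond_exp_intg[OF i2]
    and e3 = real_cond_exp_intg[OF i3] and e4 = real_cond_exp_intg[OF i4]
  have split: "a * b = of_real (Re a * Re b - Im a * Im b) + \<i> * of_real (Re a * Im b + Im a * Re b)" for a b
    by (simp add: complex_eq_iff)
  have E: "Re (complex_cond_exp M F g x) = ?ER x" "Im (complex_cond_exp M F g x) = ?EI x" for x
    by (simp_all add: complex_cond_exp_def)
  show "integrable M (\<lambda>x. p x * complex_cond_exp M F g x)"
    unfolding split[of "p _"] E
    by (intro Bochner_Integration.integrable_add Bochner_Integration.integrable_diff
        integrable_mult_right integrable_of_real e1(1) e2(1) e3(1) e4(1)) measurable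
  have "(\<integral>x. p x * complex_cond_exp M F g x \<partial>M)
      = of_real ((\<integral>x. ?Rp x * ?ER x \<partial>M) - (\<integral>x. ?Ip x * ?EI x \<partial>M))
        + \<i> * of_real ((\<integral>x. ?Rp x * ?EI x \<partial>M) + (\<integral>x. ?Ip x * ?ER x \<partial>M))"
    unfolding split[of "p _"] E
    using e1(1) e2(1) e3(1) e4(1) by (simp del: of_real_add of_real_diff of_real_mult)
  also have "\<dots> = of_real ((\<integral>x. ?Rp x * ?Rg x \<partial>M) - (\<integral>x. ?Ip x * ?Ig x \<partial>M))
        + \<i> * of_real ((\<integral>x. ?Rp x * ?Ig x \<partial>M) + (\<integral>x. ?Ip x * ?Rg x \<partial>M))"
    using e1(2) e2(2) e3(2) e4(2) by simp
  also have "\<dots> = (\<integral>x. p x * g x \<partial>M)"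
    unfolding split[of "p _"]
    using i1 i2 i3 i4 by (simp del: of_real_add of_real_diff of_real_mult)
  finally show "(\<integral>x. p x * complex_cond_exp M F g x \<partial>M) = (\<integral>x. p x * g x \<partial>M)" .
  have m1: "AE x in M. real_cond_exp M F (\<lambda>x. ?Rp x * ?Rg x) x = ?Rp x * ?ER x"
    by (rule real_cond_exp_mult) (use i1 in auto)
  have m2: "AE x in M. real_cond_exp M F (\<lambda>x. ?Ip x * ?Ig x) x = ?Ip x * ?EI x"
    by (rule real_cond_exp_mult) (use i2 in auto)
  have m3: "AE x in M. real_cond_exp M F (\<lambda>x. ?Rp x * ?Ig x) x = ?Rp x * ?EI x"
    by (rule real_cond_exp_mult) (use i3 in auto)
  have m4: "AE x in M. real_cond_exp M F (\<lambda>x. ?Ip x * ?Rg x) x = ?Ip x * ?ER x"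
    by (rule real_cond_exp_mult) (use i4 in auto)
  from m1 m2 m3 m4 real_cond_exp_diff[OF i1 i2] real_cond_exp_add[OF i3 i4]
  show "AE x in M. complex_cond_exp M F (\<lambda>y. p y * g y) x = p x * complex_cond_exp M F g x"
    by eventually_elim (simp add: complex_cond_exp_def complex_eq_iff)
qed

text \<open>
  The weight is \<open>h / (1 + E g)\<close> for a strictly positive integrable \<open>F\<close>-measurable \<open>h\<close>, set to
  zero where \<open>E g\<close> is infinite; its product with \<open>g\<close> has the integral of \<open>h E g / (1 + E g) \<le> h\<close>.
  It replaces an exhaustion by \<open>F\<close>-sets of finite measure on which \<open>E g\<close> is bounded.
\<close>

lemma obtain_integrating_weight:
  fixes g :: "'a \<Rightarrow> ennreal"
  assumes [measurable]: "g \<in> borel_measurable M"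
  obtains \<phi> :: "'a \<Rightarrow> real" where "\<phi> \<in> borel_measurable F" "\<And>x. 0 \<le> \<phi> x"
    "\<And>x. nn_cond_exp M F g x < \<infinity> \<Longrightarrow> 0 < \<phi> x" "(\<integral>\<^sup>+x. ennreal (\<phi> x) * g x \<partial>M) < \<infinity>"
proof -
  interpret R: sigma_finite_measure "restr_to_subalg M F" by (rule sigma_fin_subalg)
  obtain h :: "'a \<Rightarrow> real" where h: "h \<in> borel_measurable (restr_to_subalg M F)" "\<And>x. h x > 0"
    and hi: "integrable (restr_to_subalg M F) h"
    using R.obtain_positive_integrable_function by metis
  have [measurable]: "h \<in> borel_measurable F"
    using measurable_in_subalg'[OF subalg h(1)] .
  have hM: "integrable M h" using integrable_from_subalg[OF subalg hi] .
  let ?E = "nn_cond_exp M F g"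
  define \<phi> where "\<phi> x = (if ?E x < \<infinity> then h x / (1 + enn2real (?E x)) else 0)" for x
  have [measurable]: "\<phi> \<in> borel_measurable F" unfolding \<phi>_def by measurable
  have pointwise: "ennreal (\<phi> x) * ?E x \<le> ennreal (h x)" for x
  proof (cases "?E x")
    case (real r)
    then have "ennreal (\<phi> x) * ?E x = ennreal (h x / (1 + r) * r)"
      by (simp add: \<phi>_def ennreal_mult'' del: times_divide_eq_left)
    also have "\<dots> \<le> ennreal (h x)"
      using real h(2)[of x] by (intro ennreal_leI) (auto simp: field_simps)
    finally show ?thesis .
  qed (simp add: \<phi>_def)
  have "(\<integral>\<^sup>+x. ennreal (\<phi> x) * g x \<partial>M) = (\<integral>\<^sup>+x. ennreal (\<phi> x) * ?E x \<partial>M)"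
    by (rule nn_cond_exp_intg[symmetric]) measurable
  also have "\<dots> \<le> (\<integral>\<^sup>+x. ennreal (h x) \<partial>M)"
    by (intro nn_integral_mono pointwise)
  also have "\<dots> < \<infinity>"
    using hM h(2) by (simp add: nn_integral_eq_integral less_imp_le)
  finally have fin: "(\<integral>\<^sup>+x. ennreal (\<phi> x) * g x \<partial>M) < \<infinity>" .
  have "0 \<le> \<phi> x" for x
    using h(2)[of x] by (simp add: \<phi>_def)
  moreover have "0 < \<phi> x" if "?E x < \<infinity>" for x
    using h(2)[of x] that by (auto simp: \<phi>_def intro!: divide_pos_pos add_pos_nonneg)
  ultimately show thesis
    using that[of \<phi>] fin by simp
qed

text \<open>
  The pull-out rule on the set where \<open>g\<close> lies in the domain of \<open>E\<close>, without integrability of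
  \<open>p g\<close>: a positive \<open>F\<close>-measurable weight makes both \<open>g\<close> and \<open>p g\<close> integrable and cancels
  afterwards.
\<close>

lemma complex_cond_exp_mult:
  fixes p g :: "'a \<Rightarrow> complex"
  assumes [measurable]: "p \<in> borel_measurable F" "g \<in> borel_measurable M"
  shows "AE x in M. nn_cond_exp M F (\<lambda>y. ennreal (cmod (g y))) x < \<infinity> \<longrightarrow>
    complex_cond_exp M F (\<lambda>y. p y * g y) x = p x * complex_cond_exp M F g x"
proof -
  obtain \<phi> :: "'a \<Rightarrow> real" where [measurable]: "\<phi> \<in> borel_measurable F" and nonneg: "\<And>x. 0 \<le> \<phi> x"
    and pos: "\<And>x. nn_cond_exp M F (\<lambda>y. ennreal (cmod (g y))) x < \<infinity> \<Longrightarrow> 0 < \<phi> x"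
    and fin: "(\<integral>\<^sup>+x. ennreal (\<phi> x) * ennreal (cmod (g x)) \<partial>M) < \<infinity>"
    by (rule obtain_integrating_weight[of "\<lambda>y. ennreal (cmod (g y))"]) auto
  \<comment> \<open>The denominator compensates for an unbounded \<open>p\<close>, so that \<open>\<bar>\<psi> p g\<bar> \<le> \<phi> \<bar>g\<bar>\<close>.\<close>
  define \<psi> where "\<psi> x = complex_of_real (\<phi> x / (1 + cmod (p x)))" for x
  have [measurable]: "\<psi> \<in> borel_measurable F" unfolding \<psi>_def by measurable
  have base: "integrable M (\<lambda>x. \<phi> x * cmod (g x))"
    using fin nonneg by (intro integrableI_bounded) (auto simp: ennreal_mult abs_mult)
  have frac: "cmod (p x) / (1 + cmod (p x)) \<le> 1" for x
    by (simp add: divide_le_eq add_pos_nonneg)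
  have "cmod (\<psi> x * p x * g x) \<le> \<phi> x * cmod (g x)" for x
  proof -
    have "cmod (\<psi> x * p x * g x) = (\<phi> x * cmod (g x)) * (cmod (p x) / (1 + cmod (p x)))"
      using nonneg[of x] by (simp add: \<psi>_def norm_mult norm_divide abs_of_nonneg del: of_real_divide)
    also have "\<dots> \<le> \<phi> x * cmod (g x)"
      using mult_left_mono[OF frac[of x], of "\<phi> x * cmod (g x)"] nonneg[of x] by simp
    finally show ?thesis .
  qed
  then have int: "integrable M (\<lambda>x. \<psi> x * p x * g x)"
    using nonneg by (intro Bochner_Integration.integrable_bound[OF base]) auto
  have "AE x in M. complex_cond_exp M F (\<lambda>y. \<psi> y * p y * g y) x = \<psi> x * p x * complex_cond_exp M F g x"
    by (rule complex_cond_exp_intg(3)) (use int in auto)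
  moreover have "AE x in M. complex_cond_exp M F (\<lambda>y. \<psi> y * (p y * g y)) x
      = \<psi> x * complex_cond_exp M F (\<lambda>y. p y * g y) x"
    by (rule complex_cond_exp_intg(3)) (use int in \<open>auto simp: mult.assoc\<close>)
  ultimately show ?thesis
  proof eventually_elim
    case (elim x)
    show ?case
    proof
      assume "nn_cond_exp M F (\<lambda>y. ennreal (cmod (g y))) x < \<infinity>"
      from pos[OF this] have "\<psi> x \<noteq> 0"
        unfolding \<psi>_def of_real_eq_0_iff
        by (metis add_pos_nonneg divide_pos_pos less_irrefl norm_ge_zero zero_less_one)
      with elim show "complex_cond_exp M F (\<lambda>y. p y * g y) x = p x * complex_cond_exp M F g x"
        by (simp add: mult.assoc)
    qed
  qed
qed

lemma nn_cond_exp_eq_0_imp: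
  assumes [measurable]: "g \<in> borel_measurable M"
  shows "AE x in M. nn_cond_exp M F g x = 0 \<longrightarrow> g x = 0"
proof -
  let ?I = "\<lambda>x. if nn_cond_exp M F g x = 0 then 1 else 0 :: ennreal"
  have "(\<integral>\<^sup>+x. ?I x * g x \<partial>M) = (\<integral>\<^sup>+x. ?I x * nn_cond_exp M F g x \<partial>M)"
    by (rule nn_cond_exp_intg[symmetric]) measurable
  also have "\<dots> = 0"
    by (intro nn_integral_zero' AE_I2) auto
  finally have "AE x in M. ?I x * g x = 0"
    by (subst (asm) nn_integral_0_iff_AE) auto
  then show ?thesis
    by eventually_elim auto
qed

lemma nn_cond_exp_L2_finite:
  assumes "f \<in> L2_space M"
  shows "AE x in M. nn_cond_exp M F (\<lambda>y. ennreal ((cmod (f y))\<^sup>2)) x < \<infinity>"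
proof -
  have [measurable]: "f \<in> borel_measurable M" and int: "integrable M (\<lambda>x. (cmod (f x))\<^sup>2)"
    using assms by (auto simp: L2_space_def)
  have "(\<integral>\<^sup>+x. 1 * nn_cond_exp M F (\<lambda>y. ennreal ((cmod (f y))\<^sup>2)) x \<partial>M)
      = (\<integral>\<^sup>+x. 1 * ennreal ((cmod (f x))\<^sup>2) \<partial>M)"
    by (rule nn_cond_exp_intg) measurable
  also have "\<dots> < \<infinity>"
    using int by (simp add: nn_integral_eq_integral)
  finally have "(\<integral>\<^sup>+x. nn_cond_exp M F (\<lambda>y. ennreal ((cmod (f y))\<^sup>2)) x \<partial>M) \<noteq> \<infinity>"
    by simp
  then have "AE x in M. nn_cond_exp M F (\<lambda>y. ennreal ((cmod (f y))\<^sup>2)) x \<noteq> \<infinity>"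
    by (intro nn_integral_PInf_AE) auto
  then show ?thesis
    by eventually_elim (simp add: less_top)
qed

lemma nn_cond_exp_mult_finite:
  fixes g h :: "'a \<Rightarrow> complex"
  assumes [measurable]: "g \<in> borel_measurable M" "h \<in> borel_measurable M"
  shows "AE x in M. nn_cond_exp M F (\<lambda>y. ennreal ((cmod (g y))\<^sup>2)) x < \<infinity> \<longrightarrow>
    nn_cond_exp M F (\<lambda>y. ennreal ((cmod (h y))\<^sup>2)) x < \<infinity> \<longrightarrow>
    nn_cond_exp M F (\<lambda>y. ennreal (cmod (g y * h y))) x < \<infinity>"
proof -
  have "AE x in M. nn_cond_exp M F (\<lambda>y. ennreal (cmod (g y * h y))) x
      \<le> nn_cond_exp M F (\<lambda>y. ennreal ((cmod (g y))\<^sup>2) + ennreal ((cmod (h y))\<^sup>2)) x"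
    by (rule nn_cond_exp_mono)
      (auto intro!: AE_I2 ennreal_leI cmod_mult_le_sum_squares simp flip: ennreal_plus)
  moreover have "AE x in M. nn_cond_exp M F (\<lambda>y. ennreal ((cmod (g y))\<^sup>2)) x
        + nn_cond_exp M F (\<lambda>y. ennreal ((cmod (h y))\<^sup>2)) x
      = nn_cond_exp M F (\<lambda>y. ennreal ((cmod (g y))\<^sup>2) + ennreal ((cmod (h y))\<^sup>2)) x"
    by (rule nn_cond_exp_sum) measurable
  ultimately show ?thesis
  proof eventually_elim
    case (elim x)
    from elim(1)[unfolded elim(2)[symmetric]] show ?case
      by (intro impI) (erule order.strict_trans1, simp)
  qed
qed

end

section \<open>Square-integrable functions and adjoints\<close>

lemma L2_mult_integrable:
  assumes "f \<in> L2_space M" "g \<in> L2_space M"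
  shows "integrable M (\<lambda>x. f x * cnj (g x))"
proof -
  have [measurable]: "f \<in> borel_measurable M" "g \<in> borel_measurable M"
    and int: "integrable M (\<lambda>x. (cmod (f x))\<^sup>2)" "integrable M (\<lambda>x. (cmod (g x))\<^sup>2)"
    using assms by (auto simp: L2_space_def)
  have le: "cmod (a * cnj b) \<le> (cmod a)\<^sup>2 + (cmod b)\<^sup>2" for a b :: complex
    using cmod_mult_le_sum_squares[of a "cnj b"] by simp
  show ?thesis
    by (rule Bochner_Integration.integrable_bound[OF Bochner_Integration.integrable_add[OF int]])
      (auto intro!: le)
qed

lemma L2_space_diff:
  assumes "f \<in> L2_space M" "g \<in> L2_space M"
  shows "(\<lambda>x. f x - g x) \<in> L2_space M"
proof -
  have [measurable]: "f \<in> borel_measurable M" "g \<in> borel_measurable M"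
    and int: "integrable M (\<lambda>x. (cmod (f x))\<^sup>2)" "integrable M (\<lambda>x. (cmod (g x))\<^sup>2)"
    using assms by (auto simp: L2_space_def)
  have le: "(cmod (a - b))\<^sup>2 \<le> 2 * ((cmod a)\<^sup>2 + (cmod b)\<^sup>2)" for a b :: complex
  proof -
    have "(cmod (a - b))\<^sup>2 \<le> (cmod a + cmod b)\<^sup>2"
      by (intro power_mono norm_triangle_ineq4) simp
    also have "\<dots> \<le> 2 * ((cmod a)\<^sup>2 + (cmod b)\<^sup>2)"
      using sum_squares_bound[of "cmod a" "cmod b"] by (simp add: power2_sum)
    finally show ?thesis .
  qed
  have "integrable M (\<lambda>x. 2 * ((cmod (f x))\<^sup>2 + (cmod (g x))\<^sup>2))"
    using int by (intro integrable_mult_right Bochner_Integration.integrable_add)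
  then have "integrable M (\<lambda>x. (cmod (f x - g x))\<^sup>2)"
    by (rule Bochner_Integration.integrable_bound) (use le in auto)
  then show ?thesis by (auto simp: L2_space_def)
qed

text \<open>
  The representing function chosen as the adjoint and \<open>h\<close> have a difference that is orthogonal to
  all of \<open>L\<^sup>2\<close>, hence to itself.
\<close>

lemma L2_adjoint_unique:
  assumes h: "h \<in> L2_space M" and adj: "\<And>f. f \<in> L2_space M \<Longrightarrow> L2_inner M (T f) g = L2_inner M f h"
  shows "AE x in M. L2_adjoint M T g x = h x"
proof -
  define k where "k = L2_adjoint M T g"
  have "k \<in> L2_space M \<and> (\<forall>f\<in>L2_space M. L2_inner M (T f) g = L2_inner M f k)"
    unfolding k_def L2_adjoint_def by (rule someI[of _ h]) (use h adj in auto)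
  then have k: "k \<in> L2_space M" and kadj: "\<And>f. f \<in> L2_space M \<Longrightarrow> L2_inner M (T f) g = L2_inner M f k"
    by auto
  define d where "d = (\<lambda>x. k x - h x)"
  have d: "d \<in> L2_space M" unfolding d_def by (rule L2_space_diff[OF k h])
  then have [measurable]: "d \<in> borel_measurable M" and int: "integrable M (\<lambda>x. (cmod (d x))\<^sup>2)"
    by (auto simp: L2_space_def)
  have "complex_of_real (\<integral>x. (cmod (d x))\<^sup>2 \<partial>M) = (\<integral>x. complex_of_real ((cmod (d x))\<^sup>2) \<partial>M)"
    by (simp only: integral_complex_of_real)
  also have "\<dots> = (\<integral>x. d x * cnj (k x) - d x * cnj (h x) \<partial>M)"
    by (rule Bochner_Integration.integral_cong)
      (simp_all only: complex_norm_square, simp add: d_def algebra_simps)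
  also have "\<dots> = L2_inner M d k - L2_inner M d h"
    unfolding L2_inner_def
    by (rule Bochner_Integration.integral_diff) (rule L2_mult_integrable[OF d] k h)+
  also have "\<dots> = 0"
    using adj[OF d] kadj[OF d] by simp
  finally have "(\<integral>x. (cmod (d x))\<^sup>2 \<partial>M) = 0" by simp
  then have "AE x in M. (cmod (d x))\<^sup>2 = 0"
    using integral_nonneg_eq_0_iff_AE[OF int] by simp
  then show ?thesis
    by eventually_elim (simp add: d_def k_def)
qed

section \<open>The normal form of the operator under equality in Cauchy--Schwarz\<close>

context sigma_finite_subalgebra
begin

text \<open>
  The equality case of the conditional Cauchy--Schwarz inequality.  With
  \<open>\<kappa> = cnj (E (u w)) / E \<bar>w\<bar>\<^sup>2\<close>, the coefficient of the conditional orthogonal projection of \<open>cnj u\<close> onto \<open>w\<close>, expanding the square gives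
  \<open>E \<bar>cnj u - \<kappa> w\<bar>\<^sup>2 = E \<bar>u\<bar>\<^sup>2 - \<bar>E (u w)\<bar>\<^sup>2 / E \<bar>w\<bar>\<^sup>2 = 0\<close>; the expansion is carried out under the
  integral against a weight that makes every term integrable.
\<close>

lemma cond_cauchy_schwarz_equality_imp_collinear:
  fixes u w :: "'a \<Rightarrow> complex"
  defines "a \<equiv> nn_cond_exp M F (\<lambda>y. ennreal ((cmod (u y))\<^sup>2))"
    and "b \<equiv> nn_cond_exp M F (\<lambda>y. ennreal ((cmod (w y))\<^sup>2))"
  assumes [measurable]: "u \<in> borel_measurable M" "w \<in> borel_measurable M"
    and eq: "AE x in M. ennreal ((cmod (complex_cond_exp M F (\<lambda>y. u y * w y) x))\<^sup>2) = a x * b x"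
  obtains \<kappa> where "\<kappa> \<in> borel_measurable F"
    "AE x in M. a x * b x \<noteq> 0 \<longrightarrow> cnj (u x) = \<kappa> x * w x"
proof -
  define c where "c = complex_cond_exp M F (\<lambda>y. u y * w y)"
  have [measurable]: "a \<in> borel_measurable F" "b \<in> borel_measurable F" "c \<in> borel_measurable F"
    by (auto simp: a_def b_def c_def)
  define \<kappa> where "\<kappa> x = cnj (c x) / complex_of_real (enn2real (b x))" for x
  have [measurable]: "\<kappa> \<in> borel_measurable F" unfolding \<kappa>_def by measurable
  let ?g = "\<lambda>x. (cmod (u x))\<^sup>2 + (cmod (w x))\<^sup>2"
  obtain \<phi> :: "'a \<Rightarrow> real" where [measurable]: "\<phi> \<in> borel_measurable F" and nonneg: "\<And>x. 0 \<le> \<phi> x"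
    and pos: "\<And>x. nn_cond_exp M F (\<lambda>y. ennreal (?g y)) x < \<infinity> \<Longrightarrow> 0 < \<phi> x"
    and fin: "(\<integral>\<^sup>+x. ennreal (\<phi> x) * ennreal (?g x) \<partial>M) < \<infinity>"
    by (rule obtain_integrating_weight[of "\<lambda>y. ennreal (?g y)"]) auto
  have base: "integrable M (\<lambda>x. \<phi> x * ?g x)"
    using fin nonneg by (intro integrableI_bounded) (auto simp: ennreal_mult abs_mult)
  have Eg: "AE x in M. a x + b x = nn_cond_exp M F (\<lambda>y. ennreal (?g y)) x"
    unfolding a_def b_def using nn_cond_exp_sum[of "\<lambda>y. ennreal ((cmod (u y))\<^sup>2)" "\<lambda>y. ennreal ((cmod (w y))\<^sup>2)"]
    by (simp add: ennreal_plus)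
  \<comment> \<open>The weights of the three terms of the expanded square are \<open>\<psi>\<close>, \<open>\<psi> \<bar>\<kappa>\<bar>\<^sup>2\<close> and \<open>\<psi> \<kappa>\<close>; the
    denominator bounds all of them by \<open>\<phi>\<close>.\<close>
  define \<psi> where "\<psi> x = (if a x * b x \<noteq> 0 then \<phi> x / (1 + (cmod (\<kappa> x))\<^sup>2) else 0)" for x
  have [measurable]: "\<psi> \<in> borel_measurable F" unfolding \<psi>_def by measurable
  have \<psi>_nonneg: "0 \<le> \<psi> x" for x
    using nonneg[of x] by (simp add: \<psi>_def)
  have \<psi>_bound: "\<psi> x * t \<le> \<phi> x" if "t \<le> 1 + (cmod (\<kappa> x))\<^sup>2" for x t
  proof (cases "a x * b x = 0")
    case False
    have "0 < 1 + (cmod (\<kappa> x))\<^sup>2" by (simp add: add_pos_nonneg)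
    then show ?thesis
      using mult_left_mono[OF that, of "\<phi> x"] nonneg[of x] False
      by (simp add: \<psi>_def divide_le_eq)
  qed (simp add: \<psi>_def nonneg)
  have dominated: "integrable M (\<lambda>x. p x * q x)"
    if [measurable]: "p \<in> borel_measurable M" "q \<in> borel_measurable M"
      and p: "\<And>x. cmod (p x) \<le> \<phi> x" and q: "\<And>x. cmod (q x) \<le> ?g x" for p q :: "'a \<Rightarrow> complex"
    by (rule Bochner_Integration.integrable_bound[OF base])
      (use p q nonneg in \<open>auto simp: norm_mult abs_mult intro!: mult_mono\<close>)
  have le1: "t \<le> 1 + t\<^sup>2" for t :: real
    using sum_squares_bound[of t 1] zero_le_power2[of t] unfolding power_one mult_1_right by linarith
  let ?p1 = "\<lambda>x. complex_of_real (\<psi> x)" and ?q1 = "\<lambda>x. complex_of_real ((cmod (u x))\<^sup>2)"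
  let ?p2 = "\<lambda>x. complex_of_real (\<psi> x * (cmod (\<kappa> x))\<^sup>2)" and ?q2 = "\<lambda>x. complex_of_real ((cmod (w x))\<^sup>2)"
  let ?p3 = "\<lambda>x. complex_of_real (\<psi> x) * \<kappa> x" and ?q3 = "\<lambda>x. u x * w x"
  have q12: "cmod (?q1 x) \<le> ?g x" "cmod (?q2 x) \<le> ?g x" for x
    by (simp_all only: norm_of_real abs_power2) simp_all
  have p1: "cmod (?p1 x) \<le> \<phi> x" for x
    using \<psi>_bound[of 1 x] \<psi>_nonneg[of x] by simp
  have p2: "cmod (?p2 x) \<le> \<phi> x" for x
    using \<psi>_bound[of "(cmod (\<kappa> x))\<^sup>2" x] \<psi>_nonneg[of x]
    by (simp only: norm_of_real abs_mult abs_power2 abs_of_nonneg)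
  have p3: "cmod (?p3 x) \<le> \<phi> x" for x
    using \<psi>_bound[OF le1[of "cmod (\<kappa> x)"]] \<psi>_nonneg[of x]
    by (simp only: norm_mult norm_of_real abs_of_nonneg)
  have i1: "integrable M (\<lambda>x. ?p1 x * ?q1 x)"
    by (rule dominated[OF _ _ p1 q12(1)]) measurable
  have i2: "integrable M (\<lambda>x. ?p2 x * ?q2 x)"
    by (rule dominated[OF _ _ p2 q12(2)]) measurable
  have i3: "integrable M (\<lambda>x. ?p3 x * ?q3 x)"
    by (rule dominated[OF _ _ p3 cmod_mult_le_sum_squares]) measurable
  have mp: "?p1 \<in> borel_measurable F" "?p2 \<in> borel_measurable F" "?p3 \<in> borel_measurable F"
    by measurable
  have mq: "?q1 \<in> borel_measurable M" "?q2 \<in> borel_measurable M" "?q3 \<in> borel_measurable M"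
    by measurable
  note e1 = complex_cond_exp_intg[OF i1 mp(1) mq(1)] and e2 = complex_cond_exp_intg[OF i2 mp(2) mq(2)]
    and e3 = complex_cond_exp_intg[OF i3 mp(3) mq(3)]
  let ?D = "\<lambda>x. \<psi> x * (cmod (cnj (u x) - \<kappa> x * w x))\<^sup>2"
  let ?C = "\<lambda>P Q R :: complex. P + Q - R - cnj R"
  have C_integral: "(\<integral>x. ?C (P x) (Q x) (R x) \<partial>M) = ?C (\<integral>x. P x \<partial>M) (\<integral>x. Q x \<partial>M) (\<integral>x. R x \<partial>M)"
    if "integrable M P" "integrable M Q" "integrable M R" for P Q R :: "'a \<Rightarrow> complex"
    using that by simp
  have D: "complex_of_real (?D x) = ?C (?p1 x * ?q1 x) (?p2 x * ?q2 x) (?p3 x * ?q3 x)" for x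
    unfolding of_real_mult complex_norm_square by (simp add: algebra_simps)
  have cD: "integrable M (\<lambda>x. complex_of_real (?D x))"
    unfolding D
    by (intro Bochner_Integration.integrable_add Bochner_Integration.integrable_diff i1 i2 i3 integrable_cnj)
  then have intD: "integrable M ?D"
    using integrable_Re[OF cD] by (simp only: Re_complex_of_real)
  let ?E = "complex_cond_exp M F"
  have vanish: "AE x in M. ?C (?p1 x * ?E ?q1 x) (?p2 x * ?E ?q2 x) (?p3 x * ?E ?q3 x) = 0"
  proof -
    have "AE x in M. ?E ?q1 x = complex_of_real (enn2real (a x))"
      unfolding a_def by (rule complex_cond_exp_of_nonneg) auto
    moreover have "AE x in M. ?E ?q2 x = complex_of_real (enn2real (b x))"
      unfolding b_def by (rule complex_cond_exp_of_nonneg) auto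
    ultimately show ?thesis
      using eq
    proof eventually_elim
      case (elim x)
      show ?case
      proof (cases "a x * b x = 0")
        case False
        \<comment> \<open>The left-hand side of the hypothesis is finite; as \<open>0 * \<infinity> = 0\<close>, this bounds \<open>a\<close> and \<open>b\<close>
          separately only where the product is nonzero.\<close>
        have "a x * b x < \<top>" using elim(3) by (metis ennreal_less_top)
        with False have "a x < \<top>" "b x < \<top>" "b x \<noteq> 0"
          by (auto simp: ennreal_mult_less_top)
        then have b0: "enn2real (b x) \<noteq> 0"
          by (simp add: enn2real_eq_0_iff less_top)
        have "(cmod (c x))\<^sup>2 = enn2real (a x) * enn2real (b x)"
          using arg_cong[OF elim(3), of enn2real] by (simp add: c_def enn2real_mult)
        from arg_cong[OF this, of complex_of_real]
        have cc: "c x * cnj (c x) = complex_of_real (enn2real (a x)) * complex_of_real (enn2real (b x))"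
          by (simp only: complex_norm_square of_real_mult)
        have k1: "\<kappa> x * c x = complex_of_real (enn2real (a x))"
          using cc b0 by (simp add: \<kappa>_def field_simps)
        have k2: "complex_of_real ((cmod (\<kappa> x))\<^sup>2) * complex_of_real (enn2real (b x)) = complex_of_real (enn2real (a x))"
          unfolding complex_norm_square using cc b0 by (simp add: \<kappa>_def field_simps)
        have r: "?p3 x * ?E ?q3 x = complex_of_real (\<psi> x) * complex_of_real (enn2real (a x))"
          using k1 by (simp add: c_def mult.assoc)
        have s: "?p2 x * ?E ?q2 x = complex_of_real (\<psi> x) * complex_of_real (enn2real (a x))"
          unfolding elim(2) of_real_mult mult.assoc k2 ..
        show ?thesis
          unfolding r s elim(1) by simp
      qed (simp add: \<psi>_def)
    qed
  qed
  have "complex_of_real (\<integral>x. ?D x \<partial>M) = (\<integral>x. complex_of_real (?D x) \<partial>M)"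
    by (simp only: integral_complex_of_real)
  also have "\<dots> = ?C (\<integral>x. ?p1 x * ?q1 x \<partial>M) (\<integral>x. ?p2 x * ?q2 x \<partial>M) (\<integral>x. ?p3 x * ?q3 x \<partial>M)"
    unfolding D by (rule C_integral[OF i1 i2 i3])
  also have "\<dots> = ?C (\<integral>x. ?p1 x * ?E ?q1 x \<partial>M) (\<integral>x. ?p2 x * ?E ?q2 x \<partial>M) (\<integral>x. ?p3 x * ?E ?q3 x \<partial>M)"
    by (simp only: e1(2) e2(2) e3(2))
  also have "\<dots> = (\<integral>x. ?C (?p1 x * ?E ?q1 x) (?p2 x * ?E ?q2 x) (?p3 x * ?E ?q3 x) \<partial>M)"
    by (rule C_integral[OF e1(1) e2(1) e3(1), symmetric])
  also have "\<dots> = 0"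
    by (rule integral_eq_zero_AE[OF vanish])
  finally have "(\<integral>x. ?D x \<partial>M) = 0" by simp
  then have "AE x in M. ?D x = 0"
    using integral_nonneg_eq_0_iff_AE[OF intD] \<psi>_nonneg by simp
  then have "AE x in M. a x * b x \<noteq> 0 \<longrightarrow> cnj (u x) = \<kappa> x * w x"
    using eq Eg
  proof eventually_elim
    case (elim x)
    show ?case
    proof
      assume ab: "a x * b x \<noteq> 0"
      have "a x * b x < \<top>" using elim(2) by (metis ennreal_less_top)
      with ab have "a x + b x < \<infinity>"
        by (auto simp: ennreal_mult_less_top)
      then have "0 < \<phi> x" using pos elim(3) by simp
      then have "\<psi> x \<noteq> 0"
        using ab add_pos_nonneg[of 1 "(cmod (\<kappa> x))\<^sup>2"] by (simp add: \<psi>_def)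
      then show "cnj (u x) = \<kappa> x * w x" using elim(1) by simp
    qed
  qed
  then show thesis using that[of \<kappa>] by simp
qed

text \<open>
  Put \<open>v = w\<close> where \<open>E \<bar>u\<bar>\<^sup>2 E \<bar>w\<bar>\<^sup>2 > 0\<close> and \<open>v = 0\<close> elsewhere.  Where the product is positive,
  \<open>u = cnj (\<kappa> v)\<close> and \<open>\<kappa>\<close> is pulled out of \<open>E\<close>; where it vanishes, \<open>w = 0\<close> or \<open>E (u f) = 0\<close>, and the
  operator vanishes as well.
\<close>

lemma weighted_cond_op_normal_form:
  fixes u w :: "'a \<Rightarrow> complex"
  assumes [measurable]: "u \<in> borel_measurable M" "w \<in> borel_measurable M"
    and eq: "AE x in M. ennreal ((cmod (complex_cond_exp M F (\<lambda>y. u y * w y) x))\<^sup>2)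
           = nn_cond_exp M F (\<lambda>y. ennreal ((cmod (u y))\<^sup>2)) x
             * nn_cond_exp M F (\<lambda>y. ennreal ((cmod (w y))\<^sup>2)) x"
  obtains \<kappa> v where "\<kappa> \<in> borel_measurable F" "v \<in> borel_measurable M"
    "AE x in M. nn_cond_exp M F (\<lambda>y. ennreal ((cmod (v y))\<^sup>2)) x < \<infinity>"
    "\<And>f. f \<in> L2_space M \<Longrightarrow> AE x in M. weighted_cond_op M F w u f x
       = cnj (\<kappa> x) * v x * complex_cond_exp M F (\<lambda>y. cnj (v y) * f y) x"
proof -
  define a where "a = nn_cond_exp M F (\<lambda>y. ennreal ((cmod (u y))\<^sup>2))"
  define b where "b = nn_cond_exp M F (\<lambda>y. ennreal ((cmod (w y))\<^sup>2))"
  have [measurable]: "a \<in> borel_measurable F" "b \<in> borel_measurable F"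
    by (auto simp: a_def b_def)
  obtain \<kappa> where [measurable]: "\<kappa> \<in> borel_measurable F"
    and coll: "AE x in M. a x * b x \<noteq> 0 \<longrightarrow> cnj (u x) = \<kappa> x * w x"
    using cond_cauchy_schwarz_equality_imp_collinear[of u w] eq unfolding a_def b_def by auto
  define v where "v x = (if a x * b x \<noteq> 0 then w x else 0)" for x
  have [measurable]: "v \<in> borel_measurable M" unfolding v_def by measurable
  have sp: "space F = space M" using subalg by (simp add: subalgebra_def)
  have S: "{x \<in> space F. a x * b x \<noteq> 0} \<in> sets F" and Z: "{x \<in> space F. a x = 0} \<in> sets F"
    by measurable
  have v_fin: "AE x in M. nn_cond_exp M F (\<lambda>y. ennreal ((cmod (v y))\<^sup>2)) x < \<infinity>"
  proof -
    let ?I = "\<lambda>x. if a x * b x \<noteq> 0 then 1 else 0 :: ennreal"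
    have "AE x in M. ?I x * b x = nn_cond_exp M F (\<lambda>y. ?I y * ennreal ((cmod (w y))\<^sup>2)) x"
      unfolding b_def by (rule nn_cond_exp_prod) (auto simp: b_def[symmetric])
    moreover have "(\<lambda>y. ?I y * ennreal ((cmod (w y))\<^sup>2)) = (\<lambda>y. ennreal ((cmod (v y))\<^sup>2))"
      by (auto simp: v_def)
    ultimately have "AE x in M. nn_cond_exp M F (\<lambda>y. ennreal ((cmod (v y))\<^sup>2)) x = ?I x * b x"
      by auto
    then show ?thesis
      using eq
    proof eventually_elim
      case (elim x)
      have "a x * b x < \<top>" using elim(2) unfolding a_def b_def by (metis ennreal_less_top)
      then show ?case
        unfolding elim(1) by (auto simp: ennreal_mult_less_top)
    qed
  qed
  have "AE x in M. weighted_cond_op M F w u f x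
       = cnj (\<kappa> x) * v x * complex_cond_exp M F (\<lambda>y. cnj (v y) * f y) x" if f: "f \<in> L2_space M" for f
  proof -
    have [measurable]: "f \<in> borel_measurable M" using f by (simp add: L2_space_def)
    let ?E = "complex_cond_exp M F"
    have "AE x in M. ?E (\<lambda>y. 0 * 0) x = 0 * ?E (\<lambda>y. 0) x"
      by (rule complex_cond_exp_intg(3)) simp_all
    then have E0: "AE x in M. ?E (\<lambda>y. 0) x = 0"
      by (simp only: mult_zero_left)
    have "AE x in M. x \<in> {x \<in> space F. a x * b x \<noteq> 0} \<longrightarrow>
        ?E (\<lambda>y. u y * f y) x = ?E (\<lambda>y. cnj (\<kappa> y) * (cnj (v y) * f y)) x"
    proof (rule complex_cond_exp_local[OF S])
      show "AE x in M. x \<in> {x \<in> space F. a x * b x \<noteq> 0} \<longrightarrow> u x * f x = cnj (\<kappa> x) * (cnj (v x) * f x)"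
        using coll
      proof eventually_elim
        case (elim x)
        show ?case
        proof
          assume x: "x \<in> {x \<in> space F. a x * b x \<noteq> 0}"
          with elim have "u x = cnj (\<kappa> x * w x)" by (metis (mono_tags) complex_cnj_cnj mem_Collect_eq)
          with x show "u x * f x = cnj (\<kappa> x) * (cnj (v x) * f x)" by (simp add: v_def)
        qed
      qed
    qed measurable
    moreover have "AE x in M. x \<in> {x \<in> space F. a x = 0} \<longrightarrow> ?E (\<lambda>y. u y * f y) x = ?E (\<lambda>y. 0) x"
    proof (rule complex_cond_exp_local[OF Z])
      have "AE x in M. a x = 0 \<longrightarrow> ennreal ((cmod (u x))\<^sup>2) = 0"
        unfolding a_def by (rule nn_cond_exp_eq_0_imp) measurable
      then show "AE x in M. x \<in> {x \<in> space F. a x = 0} \<longrightarrow> u x * f x = 0"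
        by eventually_elim auto
    qed measurable
    moreover have "AE x in M. b x = 0 \<longrightarrow> ennreal ((cmod (w x))\<^sup>2) = 0"
      unfolding b_def by (rule nn_cond_exp_eq_0_imp) measurable
    moreover have "AE x in M. nn_cond_exp M F (\<lambda>y. ennreal ((cmod (cnj (v y)))\<^sup>2)) x < \<infinity> \<longrightarrow>
        nn_cond_exp M F (\<lambda>y. ennreal ((cmod (f y))\<^sup>2)) x < \<infinity> \<longrightarrow>
        nn_cond_exp M F (\<lambda>y. ennreal (cmod (cnj (v y) * f y))) x < \<infinity>"
      by (rule nn_cond_exp_mult_finite) measurable
    moreover have "AE x in M. nn_cond_exp M F (\<lambda>y. ennreal (cmod (cnj (v y) * f y))) x < \<infinity> \<longrightarrow>
        ?E (\<lambda>y. cnj (\<kappa> y) * (cnj (v y) * f y)) x = cnj (\<kappa> x) * ?E (\<lambda>y. cnj (v y) * f y) x"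
      by (rule complex_cond_exp_mult) measurable
    ultimately show ?thesis
      using E0 v_fin nn_cond_exp_L2_finite[OF f] AE_space
    proof eventually_elim
      case (elim x)
      show ?case
      proof (cases "a x * b x = 0")
        case True
        then have "w x = 0 \<or> ?E (\<lambda>y. u y * f y) x = 0" using elim sp by auto
        with True show ?thesis by (auto simp: weighted_cond_op_def v_def)
      next
        case False
        then have "?E (\<lambda>y. u y * f y) x = cnj (\<kappa> x) * ?E (\<lambda>y. cnj (v y) * f y) x"
          using elim sp by simp
        with False show ?thesis by (simp add: weighted_cond_op_def v_def)
      qed
    qed
  qed
  with v_fin show thesis using that[of \<kappa> v] by simp
qed

text \<open>
  The candidate \<open>\<kappa> v E (cnj v g)\<close> has the same modulus as \<open>T g\<close>, so it lies in \<open>L\<^sup>2\<close>.  Both inner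
  products equal \<open>\<integral> cnj \<kappa> E (cnj v f) cnj (E (cnj v g))\<close>: in each, the \<open>F\<close>-measurable factor is
  integrated against a function that may be replaced by its conditional expectation.
\<close>

lemma L2_adjoint_normal_form:
  fixes \<kappa> v :: "'a \<Rightarrow> complex"
  defines "G \<equiv> \<lambda>f. complex_cond_exp M F (\<lambda>y. cnj (v y) * f y)"
  assumes [measurable]: "\<kappa> \<in> borel_measurable F" "v \<in> borel_measurable M"
    and T: "\<And>f. f \<in> L2_space M \<Longrightarrow> T f \<in> L2_space M"
    and nf: "\<And>f. f \<in> L2_space M \<Longrightarrow> AE x in M. T f x = cnj (\<kappa> x) * v x * G f x"
    and g: "g \<in> L2_space M"
  shows "AE x in M. L2_adjoint M T g x = \<kappa> x * v x * G g x"
proof (rule L2_adjoint_unique)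
  have [measurable]: "g \<in> borel_measurable M" "T g \<in> borel_measurable M"
    using g T[OF g] by (auto simp: L2_space_def)
  have GF [measurable]: "G f \<in> borel_measurable F" for f
    by (simp add: G_def)
  have "AE x in M. (cmod (T g x))\<^sup>2 = (cmod (\<kappa> x * v x * G g x))\<^sup>2"
    using nf[OF g] by eventually_elim (simp add: norm_mult)
  moreover have "integrable M (\<lambda>x. (cmod (T g x))\<^sup>2)"
    using T[OF g] by (simp add: L2_space_def)
  ultimately have "integrable M (\<lambda>x. (cmod (\<kappa> x * v x * G g x))\<^sup>2)"
    by (subst integrable_cong_AE[symmetric]) auto
  then show h: "(\<lambda>x. \<kappa> x * v x * G g x) \<in> L2_space M"
    by (simp add: L2_space_def)
  fix f assume f: "f \<in> L2_space M"
  have [measurable]: "f \<in> borel_measurable M" "T f \<in> borel_measurable M"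
    using f T[OF f] by (auto simp: L2_space_def)
  let ?p = "\<lambda>x. cnj (\<kappa> x) * G f x" and ?q = "\<lambda>x. v x * cnj (g x)"
  have ae: "AE x in M. T f x * cnj (g x) = ?p x * ?q x"
    using nf[OF f] by eventually_elim simp
  have "integrable M (\<lambda>x. ?p x * ?q x)"
    using L2_mult_integrable[OF T[OF f] g] by (subst integrable_cong_AE[OF _ _ ae, symmetric]) auto
  then have "(\<integral>x. ?p x * complex_cond_exp M F ?q x \<partial>M) = (\<integral>x. ?p x * ?q x \<partial>M)"
    by (rule complex_cond_exp_intg(2)) measurable
  also have "\<dots> = L2_inner M (T f) g"
    unfolding L2_inner_def using ae by (intro integral_cong_AE) auto
  finally have left: "L2_inner M (T f) g = (\<integral>x. ?p x * complex_cond_exp M F ?q x \<partial>M)" ..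
  let ?r = "\<lambda>x. cnj (\<kappa> x) * cnj (G g x)" and ?s = "\<lambda>x. cnj (v x) * f x"
  have rs: "f x * cnj (\<kappa> x * v x * G g x) = ?r x * ?s x" for x
    by simp
  have "integrable M (\<lambda>x. ?r x * ?s x)"
    using L2_mult_integrable[OF f h] by (simp only: rs)
  then have "(\<integral>x. ?r x * complex_cond_exp M F ?s x \<partial>M) = (\<integral>x. ?r x * ?s x \<partial>M)"
    by (rule complex_cond_exp_intg(2)) measurable
  moreover have "complex_cond_exp M F ?s = G f"
    by (simp only: G_def)
  ultimately have right: "L2_inner M f (\<lambda>x. \<kappa> x * v x * G g x) = (\<integral>x. ?r x * G f x \<partial>M)"
    by (simp only: L2_inner_def rs)
  have "complex_cond_exp M F ?q x = cnj (G g x)" for x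
    unfolding G_def complex_cond_exp_cnj[symmetric] by simp
  then show "L2_inner M (T f) g = L2_inner M f (\<lambda>x. \<kappa> x * v x * G g x)"
    unfolding left right by (simp add: mult_ac)
qed

text \<open>
  Applying \<open>E (cnj v \<cdot>)\<close> to the eigenvalue equation gives \<open>(cnj \<kappa> E \<bar>v\<bar>\<^sup>2 - z) G = 0\<close> for
  \<open>G = E (cnj v f)\<close>.  Where \<open>G \<noteq> 0\<close> this forces \<open>z = cnj \<kappa> E \<bar>v\<bar>\<^sup>2\<close>, so passing from \<open>\<kappa>\<close> to \<open>cnj \<kappa>\<close>
  turns \<open>z\<close> into \<open>cnj z\<close>; where \<open>G = 0\<close>, both \<open>z f\<close> and the right-hand side vanish.
\<close>

lemma normal_form_eigenvector:
  fixes \<kappa> v :: "'a \<Rightarrow> complex"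
  defines "G \<equiv> \<lambda>f. complex_cond_exp M F (\<lambda>y. cnj (v y) * f y)"
  assumes [measurable]: "\<kappa> \<in> borel_measurable F" "v \<in> borel_measurable M"
    and v: "AE x in M. nn_cond_exp M F (\<lambda>y. ennreal ((cmod (v y))\<^sup>2)) x < \<infinity>"
    and f: "f \<in> L2_space M"
    and eig: "AE x in M. cnj (\<kappa> x) * v x * G f x = z * f x"
  shows "AE x in M. \<kappa> x * v x * G f x = cnj z * f x"
proof (cases "z = 0")
  case True
  from eig show ?thesis
    by eventually_elim (use True in auto)
next
  case False
  have [measurable]: "f \<in> borel_measurable M" "G f \<in> borel_measurable F"
    using f by (auto simp: L2_space_def G_def)
  let ?E = "complex_cond_exp M F"
  define b where "b = nn_cond_exp M F (\<lambda>y. ennreal ((cmod (v y))\<^sup>2))"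
  let ?v2 = "\<lambda>y. complex_of_real ((cmod (v y))\<^sup>2)"
  have "AE x in M. ?E (\<lambda>y. (cnj (\<kappa> y) * G f y) * ?v2 y) x = ?E (\<lambda>y. z * (cnj (v y) * f y)) x"
  proof (rule complex_cond_exp_cong)
    show "AE x in M. cnj (\<kappa> x) * G f x * ?v2 x = z * (cnj (v x) * f x)"
      using eig
    proof eventually_elim
      case (elim x)
      have "cnj (\<kappa> x) * G f x * ?v2 x = cnj (v x) * (cnj (\<kappa> x) * v x * G f x)"
        unfolding complex_norm_square by simp
      then show ?case unfolding elim by simp
    qed
  qed measurable
  moreover have "AE x in M. b x < \<infinity> \<longrightarrow>
      ?E (\<lambda>y. (cnj (\<kappa> y) * G f y) * ?v2 y) x = (cnj (\<kappa> x) * G f x) * ?E ?v2 x"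
    using complex_cond_exp_mult[of "\<lambda>y. cnj (\<kappa> y) * G f y" ?v2]
    by (simp only: b_def norm_of_real abs_power2) measurable
  moreover have "AE x in M. nn_cond_exp M F (\<lambda>y. ennreal (cmod (cnj (v y) * f y))) x < \<infinity> \<longrightarrow>
      ?E (\<lambda>y. z * (cnj (v y) * f y)) x = z * ?E (\<lambda>y. cnj (v y) * f y) x"
    by (rule complex_cond_exp_mult) measurable
  moreover have "AE x in M. b x < \<infinity> \<longrightarrow>
      nn_cond_exp M F (\<lambda>y. ennreal ((cmod (f y))\<^sup>2)) x < \<infinity> \<longrightarrow>
      nn_cond_exp M F (\<lambda>y. ennreal (cmod (cnj (v y) * f y))) x < \<infinity>"
    using nn_cond_exp_mult_finite[of "\<lambda>y. cnj (v y)" f] by (simp only: b_def complex_mod_cnj) measurable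
  moreover have "AE x in M. ?E ?v2 x = complex_of_real (enn2real (b x))"
    unfolding b_def by (rule complex_cond_exp_of_nonneg) auto
  ultimately show ?thesis
    using v[folded b_def] nn_cond_exp_L2_finite[OF f] eig
  proof eventually_elim
    case (elim x)
    let ?b = "complex_of_real (enn2real (b x))"
    have "cnj (\<kappa> x) * G f x * ?b = ?E (\<lambda>y. (cnj (\<kappa> y) * G f y) * ?v2 y) x"
      unfolding elim(2)[THEN mp, OF elim(6)] elim(5) ..
    also have "\<dots> = ?E (\<lambda>y. z * (cnj (v y) * f y)) x"
      by (rule elim(1))
    also have "\<dots> = z * G f x"
      unfolding G_def by (rule elim(3)[THEN mp, OF elim(4)[THEN mp, THEN mp, OF elim(6,7)]])
    finally have key: "cnj (\<kappa> x) * G f x * ?b = z * G f x" .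
    show ?case
    proof (cases "G f x = 0")
      case True
      then show ?thesis using elim(8) False by simp
    next
      case G: False
      with key have z: "z = cnj (\<kappa> x) * ?b" by simp
      with False have nz: "cnj (\<kappa> x) \<noteq> 0" "?b \<noteq> 0" by auto
      have "v x * G f x = ?b * f x"
        using elim(8) nz(1) unfolding z by (simp add: mult.assoc)
      then show ?thesis
        unfolding z by (simp add: mult.assoc)
    qed
  qed
qed

end

theorem theorem3p3:
  fixes M F :: "'a measure" and u w :: "'a \<Rightarrow> complex"
  assumes "complete_measure M" and "sigma_finite_measure M"
    and "sigma_finite_subalgebra M F"
    and "u \<in> cond_exp_dom M F" and "w \<in> cond_exp_dom M F"
    and "L2_bounded M (weighted_cond_op M F w u)"
    and "AE x in M. ennreal ((cmod (complex_cond_exp M F (\<lambda>y. u y * w y) x))\<^sup>2)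
           = nn_cond_exp M F (\<lambda>y. ennreal ((cmod (u y))\<^sup>2)) x
             * nn_cond_exp M F (\<lambda>y. ennreal ((cmod (w y))\<^sup>2)) x"
  shows "point_spectrum M (weighted_cond_op M F w u)
           = joint_point_spectrum M (weighted_cond_op M F w u)"
proof (rule equalityI)
  let ?T = "weighted_cond_op M F w u"
  interpret sigma_finite_subalgebra M F by (rule assms(3))
  have uw: "u \<in> borel_measurable M" "w \<in> borel_measurable M"
    using assms(4,5) by (auto simp: cond_exp_dom_def)
  obtain \<kappa> v where meas: "\<kappa> \<in> borel_measurable F" "v \<in> borel_measurable M"
    and v: "AE x in M. nn_cond_exp M F (\<lambda>y. ennreal ((cmod (v y))\<^sup>2)) x < \<infinity>"
    and nf: "\<And>f. f \<in> L2_space M \<Longrightarrow> AE x in M. ?T f x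
       = cnj (\<kappa> x) * v x * complex_cond_exp M F (\<lambda>y. cnj (v y) * f y) x"
    by (rule weighted_cond_op_normal_form[OF uw assms(7)], rule that)
  have T: "\<And>f. f \<in> L2_space M \<Longrightarrow> ?T f \<in> L2_space M"
    using assms(6) by (simp add: L2_bounded_def)
  show "point_spectrum M ?T \<subseteq> joint_point_spectrum M ?T"
  proof
    fix z assume "z \<in> point_spectrum M ?T"
    then obtain f where f: "f \<in> L2_space M" "L2_norm M f = 1"
      and eig: "AE x in M. ?T f x - z * f x = 0"
      by (auto simp: point_spectrum_def)
    from eig nf[OF f(1)]
    have "AE x in M. cnj (\<kappa> x) * v x * complex_cond_exp M F (\<lambda>y. cnj (v y) * f y) x = z * f x"
      by eventually_elim simp
    then have "AE x in M. \<kappa> x * v x * complex_cond_exp M F (\<lambda>y. cnj (v y) * f y) x = cnj z * f x"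
      by (rule normal_form_eigenvector[OF meas v f(1)])
    moreover have "AE x in M. L2_adjoint M ?T f x
        = \<kappa> x * v x * complex_cond_exp M F (\<lambda>y. cnj (v y) * f y) x"
      by (rule L2_adjoint_normal_form[OF meas]) (erule T nf | rule f(1))+
    ultimately have "AE x in M. L2_adjoint M ?T f x - cnj z * f x = 0"
      by eventually_elim simp
    with f eig show "z \<in> joint_point_spectrum M ?T"
      by (auto simp: joint_point_spectrum_def)
  qed
  show "joint_point_spectrum M ?T \<subseteq> point_spectrum M ?T"
    by (auto simp: joint_point_spectrum_def point_spectrum_def)
qed

end
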